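(* There are TRSs that are incrementally polynomially terminating over $\mathbb{Q}$ but not incrementally polynomially terminating over $\mathbb{N}$.
   Context: For $D = \mathbb{Q}$: $D_0 = \{x\in\mathbb{Q}: x\ge0\}$; a polynomial interpretation over $\mathbb{Q}$ consists of rational $\delta>0$ and for each $n$-ary symbol $f$ a polynomial $f_\mathbb{Q} \in \mathbb{Q}[x_1,\dots,x_n]$ with $f_\mathbb{Q}(D_0^n)\subseteq D_0$; its strict order is $x>y$ iff $x-y\ge\delta$ (on $D_0$), its weak order is $\ge$ on $D_0$. For $D=\mathbb{N}$: a polynomial interpretation assigns $f_\mathbb{N}\in\mathbb{Z}[x_1,\dots,x_n]$ with $f_\mathbb{N}(\mathbb{N}^n)\subseteq\mathbb{N}$ and $f_\mathbb{N}$ strictly monotone w.r.t. the standard $>$ on $\mathbb{N}$; strict order $>$, weak order $\ge$ on $\mathbb{N}$. Terms are evaluated under assignments into the carrier. An interpretation is strictly (weakly) monotone if every interpretation function is monotone in each argument w.r.t. the strict (weak) order, and (weakly) compatible with a TRS if $[\alpha](\ell)>[\alpha](r)$ ($\ge$) for all rules $\ell\to r$ and all assignments $\alpha$. A TRS $\mathcal{R}$ is polynomially terminating over $D$ if some strictly monotone polynomial interpretation over $D$ is compatible with it. For $n\ge1$, $\mathcal{R}$ is polynomially terminating over $D$ in $n$ steps if either $n=1$ and $\mathcal{R}$ is polynomially terminating over $D$, or $n>1$ and there are a polynomial interpretation $\mathcal{P}$ over $D$ and nonempty $\mathcal{S}\subsetneq\mathcal{R}$ such that $\mathcal{P}$ is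 weakly and strictly monotone, weakly compatible with all of $\mathcal{R}$, compatible with all rules of $\mathcal{S}$, and $\mathcal{R}\setminus\mathcal{S}$ is polynomially terminating over $D$ in $n-1$ steps. $\mathcal{R}$ is incrementally polynomially terminating over $D$ if this holds for some $n\ge1$. *)

theory Defs
  imports Complex_Main "HOL-Library.Poly_Mapping"
begin

datatype (funs: 'f, vars: 'v) trm = Var 'v | Fun 'f "('f, 'v) trm list"

text \<open>A fixed-arity signature maps each of its symbols to the arity of that symbol;
  identifiers mapped to \<open>None\<close> do not belong to the signature.\<close>

type_synonym 'f signature = "'f \<rightharpoonup> nat"

type_synonym ('f, 'v) rule = "('f, 'v) trm \<times> ('f, 'v) trm"

fun wf_trm :: "'f signature \<Rightarrow> ('f, 'v) trm \<Rightarrow> bool" where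
  "wf_trm F (Var x) = True"
| "wf_trm F (Fun f ts) = (F f = Some (length ts) \<and> (\<forall>t\<in>set ts. wf_trm F t))"

definition is_rule :: "'f signature \<Rightarrow> ('f, 'v) rule \<Rightarrow> bool" where
  "is_rule F = (\<lambda>(l, r). wf_trm F l \<and> wf_trm F r \<and> (\<forall>x. l \<noteq> Var x) \<and> vars r \<subseteq> vars l)"

definition is_trs :: "'f signature \<Rightarrow> ('f, 'v) rule set \<Rightarrow> bool" where
  "is_trs F R \<longleftrightarrow> finite R \<and> (\<forall>\<rho>\<in>R. is_rule F \<rho>)"

text \<open>A monomial is a finitely supported exponent vector; a polynomial in the indeterminates
  $x_0, x_1, \ldots$ is a finitely supported map from monomials to coefficients.\<close>

type_synonym 'a mpoly = "(nat \<Rightarrow>\<^sub>0 nat) \<Rightarrow>\<^sub>0 'a"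

definition mpoly_vars :: "'a::zero mpoly \<Rightarrow> nat set" where
  "mpoly_vars p = (\<Union>m\<in>Poly_Mapping.keys p. Poly_Mapping.keys m)"

text \<open>Only applied to argument lists \<open>xs\<close> with \<open>mpoly_vars p \<subseteq> {..<length xs}\<close>.\<close>

definition mpoly_eval :: "'a::comm_semiring_1 mpoly \<Rightarrow> 'a list \<Rightarrow> 'a" where
  "mpoly_eval p xs =
     (\<Sum>m\<in>Poly_Mapping.keys p.
        Poly_Mapping.lookup p m *
        (\<Prod>i\<in>Poly_Mapping.keys m. (xs ! i) ^ Poly_Mapping.lookup m i))"

definition carr :: "'a::linordered_idom set" where
  "carr = {x. 0 \<le> x}"

definition well_defined :: "'f signature \<Rightarrow> ('f \<Rightarrow> 'a::linordered_idom mpoly) \<Rightarrow> bool" where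
  "well_defined F P \<longleftrightarrow>
     (\<forall>f n. F f = Some n \<longrightarrow>
        mpoly_vars (P f) \<subseteq> {..<n} \<and>
        (\<forall>xs. length xs = n \<and> set xs \<subseteq> carr \<longrightarrow> mpoly_eval (P f) xs \<in> carr))"

fun eval_trm :: "('f \<Rightarrow> 'a::comm_semiring_1 mpoly) \<Rightarrow> ('v \<Rightarrow> 'a) \<Rightarrow> ('f, 'v) trm \<Rightarrow> 'a" where
  "eval_trm P \<alpha> (Var x) = \<alpha> x"
| "eval_trm P \<alpha> (Fun f ts) = mpoly_eval (P f) (map (eval_trm P \<alpha>) ts)"

definition monotone_wrt ::
    "('a \<Rightarrow> 'a \<Rightarrow> bool) \<Rightarrow> 'f signature \<Rightarrow> ('f \<Rightarrow> 'a::linordered_idom mpoly) \<Rightarrow> bool" where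
  "monotone_wrt ord F P \<longleftrightarrow>
     (\<forall>f n xs i y. F f = Some n \<and> length xs = n \<and> set xs \<subseteq> carr \<and> i < n \<and> y \<in> carr \<and>
        ord y (xs ! i) \<longrightarrow> ord (mpoly_eval (P f) (xs[i := y])) (mpoly_eval (P f) xs))"

definition compatible_wrt ::
    "('a \<Rightarrow> 'a \<Rightarrow> bool) \<Rightarrow> ('f \<Rightarrow> 'a::linordered_idom mpoly) \<Rightarrow> ('f, 'v) rule set \<Rightarrow> bool" where
  "compatible_wrt ord P R \<longleftrightarrow>
     (\<forall>(l, r)\<in>R. \<forall>\<alpha>. range \<alpha> \<subseteq> carr \<longrightarrow> ord (eval_trm P \<alpha> l) (eval_trm P \<alpha> r))"

text \<open>A polynomial interpretation is a pair of a strict order and a family of polynomials;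
  its weak order is always \<open>(\<ge>)\<close>.\<close>

type_synonym ('f, 'a) interp = "('a \<Rightarrow> 'a \<Rightarrow> bool) \<times> ('f \<Rightarrow> 'a mpoly)"

definition interps_rat :: "'f signature \<Rightarrow> ('f, rat) interp set" where
  "interps_rat F = {(\<lambda>x y. x - y \<ge> \<delta>, P) | \<delta> P. \<delta> > 0 \<and> well_defined F P}"

text \<open>The coefficients are integers and the naturals are represented by the carrier
  \<open>{x::int. 0 \<le> x}\<close>. Strict monotonicity is part of the notion of interpretation here.\<close>

definition interps_nat :: "'f signature \<Rightarrow> ('f, int) interp set" where
  "interps_nat F = {((>), P) | P. well_defined F P \<and> monotone_wrt (>) F P}"

definition poly_terminating ::
    "('f, 'a::linordered_idom) interp set \<Rightarrow> 'f signature \<Rightarrow> ('f, 'v) rule set \<Rightarrow> bool" where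
  "poly_terminating \<I> F R \<longleftrightarrow>
     (\<exists>(gt, P)\<in>\<I>. monotone_wrt gt F P \<and> compatible_wrt gt P R)"

fun poly_terminating_in ::
    "('f, 'a::linordered_idom) interp set \<Rightarrow> 'f signature \<Rightarrow> nat \<Rightarrow> ('f, 'v) rule set \<Rightarrow> bool" where
  "poly_terminating_in \<I> F 0 R = False"
| "poly_terminating_in \<I> F (Suc 0) R = poly_terminating \<I> F R"
| "poly_terminating_in \<I> F (Suc (Suc n)) R =
     (\<exists>(gt, P)\<in>\<I>. \<exists>S. S \<noteq> {} \<and> S \<subset> R \<and>
        monotone_wrt (\<ge>) F P \<and> monotone_wrt gt F P \<and>
        compatible_wrt (\<ge>) P R \<and> compatible_wrt gt P S \<and>
        poly_terminating_in \<I> F (Suc n) (R - S))"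

definition incr_poly_terminating ::
    "('f, 'a::linordered_idom) interp set \<Rightarrow> 'f signature \<Rightarrow> ('f, 'v) rule set \<Rightarrow> bool" where
  "incr_poly_terminating \<I> F R \<longleftrightarrow> (\<exists>n\<ge>1. poly_terminating_in \<I> F n R)"

definition incr_poly_terminating_rat :: "'f signature \<Rightarrow> ('f, 'v) rule set \<Rightarrow> bool" where
  "incr_poly_terminating_rat F R \<longleftrightarrow> incr_poly_terminating (interps_rat F) F R"

definition incr_poly_terminating_nat :: "'f signature \<Rightarrow> ('f, 'v) rule set \<Rightarrow> bool" where
  "incr_poly_terminating_nat F R \<longleftrightarrow> incr_poly_terminating (interps_nat F) F R"

end

theory Submission
  imports Defs "HOL-Computational_Algebra.Polynomial"
begin

text \<open>
  Write \<open>f\<close>, \<open>a\<close>, \<open>g\<close> for the symbols \<open>0\<close>, \<open>1\<close>, \<open>2\<close>. Over the natural numbers no strictly monotone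
  interpretation is even weakly compatible with the four rules of \<open>trs\<close>, so neither a direct nor an
  incremental proof can start. The rule \<open>g(f(x)) \<rightarrow> f(f(g(x)))\<close> forces \<open>f\<close> to have degree 1, with
  slope \<open>s\<close> say; then \<open>f(f(x)) \<rightarrow> a(x,x)\<close> bounds \<open>a\<close> linearly, so it is \<open>p x + q y + r\<close> with
  \<open>2 \<le> p + q \<le> s\<^sup>2\<close>. Associativity gives \<open>q = 1\<close>, and the last rule gives \<open>s\<^sup>4 \<le> 4 p + 1 \<le> 4 s\<^sup>2 - 3\<close>,
  that is, \<open>(s\<^sup>2 - 1) (s\<^sup>2 - 3) \<le> 0\<close>. Hence \<open>2 \<le> s\<^sup>2 \<le> 3\<close>, which no integer satisfies, whereas
  \<open>s = 3/2\<close> works over the rationals.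
\<close>

section \<open>Evaluation of multivariate polynomials\<close>

text \<open>Terms outside the support vanish. A common index set lets sums of polynomials be
  compared even when coefficients cancel.\<close>

lemma mpoly_eval_superset:
  assumes "finite K" "Poly_Mapping.keys p \<subseteq> K"
  shows "mpoly_eval p xs =
    (\<Sum>m\<in>K. Poly_Mapping.lookup p m *
        (\<Prod>i\<in>Poly_Mapping.keys m. (xs ! i) ^ Poly_Mapping.lookup m i))"
  unfolding mpoly_eval_def
  by (rule sum.mono_neutral_left) (use assms in \<open>auto simp: in_keys_iff\<close>)

lemma mpoly_eval_add: "mpoly_eval (p + q) xs = mpoly_eval p xs + mpoly_eval q xs"
proof -
  let ?K = "Poly_Mapping.keys p \<union> Poly_Mapping.keys q"
  have "mpoly_eval (p + q) xs = (\<Sum>m\<in>?K. Poly_Mapping.lookup (p + q) m *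
        (\<Prod>i\<in>Poly_Mapping.keys m. (xs ! i) ^ Poly_Mapping.lookup m i))"
    by (rule mpoly_eval_superset) (use Poly_Mapping.keys_add[of p q] in auto)
  also have "\<dots> = mpoly_eval p xs + mpoly_eval q xs"
    by (simp add: mpoly_eval_superset[of ?K] lookup_add distrib_right sum.distrib)
  finally show ?thesis .
qed

lemma mpoly_eval_single:
  "mpoly_eval (Poly_Mapping.single m c) xs =
    c * (\<Prod>i\<in>Poly_Mapping.keys m. (xs ! i) ^ Poly_Mapping.lookup m i)"
  by (subst mpoly_eval_superset[of "{m}"]) auto

lemma mpoly_vars_add: "mpoly_vars (p + q) \<subseteq> mpoly_vars p \<union> mpoly_vars q"
  using Poly_Mapping.keys_add[of p q] unfolding mpoly_vars_def by blast

lemma mpoly_vars_single: "mpoly_vars (Poly_Mapping.single m c) \<subseteq> Poly_Mapping.keys m"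
  by (auto simp: mpoly_vars_def split: if_splits)

text \<open>Reduces questions about one argument of an interpretation function to univariate
  polynomials.\<close>

lemma mpoly_eval_update_poly:
  obtains P where "\<And>t. mpoly_eval p (xs[i := t]) = poly P t"
proof -
  define X where "X t j = xs[i := t] ! j" for t j
  have X: "\<exists>P. \<forall>t. X t j = poly P t" for j
  proof (cases "j = i \<and> i < length xs")
    case True
    then have "\<forall>t. X t j = poly [:0, 1:] t" by (simp add: X_def)
    then show ?thesis by blast
  next
    case False
    then have "\<forall>t. X t j = poly [:xs ! j:] t"
      by (cases "i < length xs") (auto simp: X_def list_update_beyond)
    then show ?thesis by blast
  qed
  then obtain Q where Q: "\<And>t j. X t j = poly (Q j) t" by metis
  show ?thesis
  proof (rule that)
    show "mpoly_eval p (xs[i := t]) =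
      poly (\<Sum>m\<in>Poly_Mapping.keys p. smult (Poly_Mapping.lookup p m)
          (\<Prod>j\<in>Poly_Mapping.keys m. Q j ^ Poly_Mapping.lookup m j)) t" for t
      unfolding mpoly_eval_def X_def[symmetric] Q
      by (simp add: poly_sum poly_prod)
  qed
qed

section \<open>Growth of integer polynomials on the natural numbers\<close>

text \<open>Otherwise \<open>- p\<close>, cast to the reals, is eventually bounded below by its
  positive leading coefficient, so \<open>p\<close> is negative at a large natural number.\<close>

lemma lead_coeff_nonneg:
  fixes p :: "int poly"
  assumes "\<And>n. 0 \<le> n \<Longrightarrow> 0 \<le> poly p n"
  shows "0 \<le> lead_coeff p"
proof (rule ccontr)
  let ?q = "map_poly real_of_int (- p)"
  assume neg: "\<not> 0 \<le> lead_coeff p"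
  have lc: "lead_coeff ?q = real_of_int (- lead_coeff p)"
    by (simp add: degree_map_poly coeff_map_poly)
  then have "0 < lead_coeff ?q" using neg by linarith
  from poly_pinfty_gt_lc[OF this] obtain k where
    k: "\<And>x. x \<ge> k \<Longrightarrow> lead_coeff ?q \<le> poly ?q x" by blast
  define n where "n = max 0 \<lceil>k\<rceil>"
  have "k \<le> real_of_int n" unfolding n_def by linarith
  from k[OF this] have "0 < poly ?q (real_of_int n)" using \<open>0 < lead_coeff ?q\<close> by linarith
  moreover have "poly ?q (real_of_int n) = real_of_int (poly (- p) n)"
    by (simp add: poly_altdef degree_map_poly coeff_map_poly sum_negf)
  ultimately have "poly p n < 0" by simp
  moreover have "0 \<le> n" by (simp add: n_def)
  ultimately show False using assms[of n] by linarith
qed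

text \<open>If \<open>q\<close> had the larger degree, \<open>q\<close> and \<open>p - q\<close>
  would have opposite leading coefficients, both nonnegative, hence zero.\<close>

lemma degree_le_if_poly_le:
  fixes p q :: "int poly"
  assumes le: "\<And>n. 0 \<le> n \<Longrightarrow> poly q n \<le> poly p n"
    and nonneg: "\<And>n. 0 \<le> n \<Longrightarrow> 0 \<le> poly q n"
  shows "degree q \<le> degree p"
proof (rule ccontr)
  assume less: "\<not> degree q \<le> degree p"
  have "lead_coeff (p - q) = - lead_coeff q"
    using less degree_add_eq_right[of p "- q"] by (simp add: coeff_eq_0 not_le)
  moreover have "0 \<le> lead_coeff (p - q)"
    by (rule lead_coeff_nonneg) (simp add: le)
  moreover have "0 \<le> lead_coeff q" by (rule lead_coeff_nonneg) (rule nonneg)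
  ultimately have "lead_coeff q = 0" by linarith
  then show False using less by simp
qed

lemma poly_degree_le_1:
  fixes p :: "'a::comm_semiring_1 poly"
  assumes "degree p \<le> 1"
  shows "poly p x = coeff p 1 * x + coeff p 0"
proof -
  have "poly p x = (\<Sum>i\<le>1. coeff p i * x ^ i)"
    unfolding poly_altdef
    by (rule sum.mono_neutral_left) (use assms in \<open>auto simp: coeff_eq_0\<close>)
  then show ?thesis by (simp add: add.commute)
qed

lemma poly_linear_if_bounded:
  fixes p :: "int poly"
  assumes "\<And>n. 0 \<le> n \<Longrightarrow> 0 \<le> poly p n" "\<And>n. 0 \<le> n \<Longrightarrow> poly p n \<le> c * n + d"
  obtains u v where "\<And>n. poly p n = u * n + v"
proof -
  have "degree p \<le> degree [:d, c:]"
    by (rule degree_le_if_poly_le) (use assms in \<open>auto simp: algebra_simps\<close>)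
  also have "\<dots> \<le> 1" by simp
  finally show thesis using poly_degree_le_1 that by blast
qed

lemma linear_le_imp_slope_le:
  fixes c :: int
  assumes "\<And>n. 0 \<le> n \<Longrightarrow> c * n + d \<le> c' * n + d'"
  shows "c \<le> c'"
proof (rule ccontr)
  assume "\<not> c \<le> c'"
  \<comment> \<open>At this argument a slope gap of at least 1 already outweighs the gap between the
    constants.\<close>
  then have "1 * (\<bar>d' - d\<bar> + 1) \<le> (c - c') * (\<bar>d' - d\<bar> + 1)"
    by (intro mult_right_mono) auto
  then show False using assms[of "\<bar>d' - d\<bar> + 1"] by (simp add: algebra_simps)
qed

text \<open>The bound makes \<open>A\<close> affine in each argument separately, which leaves only a
  mixed term \<open>k * x * y\<close>; on the diagonal that term is quadratic and so contradicts the
  linear bound unless \<open>k = 0\<close>.\<close>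

lemma biaffine_if_bounded:
  fixes A :: "int \<Rightarrow> int \<Rightarrow> int"
  assumes poly1: "\<And>y. \<exists>P. \<forall>x. A x y = poly P x"
    and poly2: "\<And>x. \<exists>P. \<forall>y. A x y = poly P y"
    and nonneg: "\<And>x y. 0 \<le> x \<Longrightarrow> 0 \<le> y \<Longrightarrow> 0 \<le> A x y"
    and bound: "\<And>x y. 0 \<le> x \<Longrightarrow> 0 \<le> y \<Longrightarrow> A x y \<le> c * (x + y) + d"
  obtains p q r where "\<And>x y. 0 \<le> y \<Longrightarrow> A x y = p * x + q * y + r"
proof -
  have lin1: "\<exists>u v. \<forall>x. A x y = u * x + v" if "0 \<le> y" for y
  proof -
    from poly1[of y] obtain P where P: "\<And>x. A x y = poly P x" by blast
    have "0 \<le> poly P n" "poly P n \<le> c * n + (c * y + d)" if "0 \<le> n" for n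
      using nonneg[OF that \<open>0 \<le> y\<close>] bound[OF that \<open>0 \<le> y\<close>]
      by (simp_all add: P algebra_simps)
    from poly_linear_if_bounded[OF this] show ?thesis by (metis P)
  qed
  have lin2: "\<exists>u v. \<forall>y. A x y = u * y + v" if "0 \<le> x" for x
  proof -
    from poly2[of x] obtain P where P: "\<And>y. A x y = poly P y" by blast
    have "0 \<le> poly P n" "poly P n \<le> c * n + (c * x + d)" if "0 \<le> n" for n
      using nonneg[OF \<open>0 \<le> x\<close> that] bound[OF \<open>0 \<le> x\<close> that]
      by (simp_all add: P algebra_simps)
    from poly_linear_if_bounded[OF this] show ?thesis by (metis P)
  qed
  \<comment> \<open>For fixed \<open>y\<close>, the affine map in \<open>x\<close> is determined by
    its values at 0 and 1.\<close>
  from lin2[of 0] obtain q r where A0: "\<And>y. A 0 y = q * y + r" by auto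
  from lin2[of 1] obtain q' r' where A1: "\<And>y. A 1 y = q' * y + r'" by auto
  define k where "k = q' - q"
  have A: "A x y = (r' - r) * x + q * y + r + k * x * y" if y: "0 \<le> y" for x y
  proof -
    from lin1[OF y] obtain u v where uv: "\<And>x. A x y = u * x + v" by blast
    have v: "v = q * y + r" using uv[of 0] A0[of y] by simp
    have u: "u = k * y + (r' - r)" using uv[of 1] A1[of y] v by (simp add: k_def algebra_simps)
    show ?thesis unfolding uv u v by (simp add: algebra_simps)
  qed
  have "k = 0"
  proof -
    let ?P = "[:r, r' - r + q, k:]"
    have P: "poly ?P n = A n n" if "0 \<le> n" for n
      using A[OF that, of n] by (simp add: algebra_simps)
    have "degree ?P \<le> degree [:d, 2 * c:]"
    proof (rule degree_le_if_poly_le)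
      fix n :: int assume n: "0 \<le> n"
      show "0 \<le> poly ?P n" unfolding P[OF n] by (rule nonneg[OF n n])
      show "poly ?P n \<le> poly [:d, 2 * c:] n"
        unfolding P[OF n] using bound[OF n n] by (simp add: algebra_simps)
    qed
    then show "k = 0" by (auto split: if_splits)
  qed
  with A show thesis by (intro that[of "r' - r" q r]) simp
qed

section \<open>The term rewrite system\<close>

abbreviation f_trm :: "(nat, nat) trm \<Rightarrow> (nat, nat) trm" where
  "f_trm t \<equiv> Fun 0 [t]"

abbreviation a_trm :: "(nat, nat) trm \<Rightarrow> (nat, nat) trm \<Rightarrow> (nat, nat) trm" where
  "a_trm s t \<equiv> Fun (Suc 0) [s, t]"

abbreviation g_trm :: "(nat, nat) trm \<Rightarrow> (nat, nat) trm" where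
  "g_trm t \<equiv> Fun 2 [t]"

definition sig :: "nat signature" where
  "sig = [0 \<mapsto> 1, Suc 0 \<mapsto> 2, 2 \<mapsto> 1]"

definition trs :: "(nat, nat) rule set" where
  "trs = (let x = Var 0; y = Var 1; z = Var 2 in
    {(g_trm (f_trm x), f_trm (f_trm (g_trm x))),
     (f_trm (f_trm x), a_trm x x),
     (a_trm (a_trm x y) z, a_trm x (a_trm y z)),
     (a_trm x (a_trm x (a_trm x (a_trm x x))), f_trm (f_trm (f_trm (f_trm x))))})"

lemma sig_simps: "sig 0 = Some 1" "sig (Suc 0) = Some 2" "sig 2 = Some 1"
  by (auto simp: sig_def)

lemma sig_cases:
  assumes "sig h = Some n"
  obtains "h = 0" "n = 1" | "h = Suc 0" "n = 2" | "h = 2" "n = 1"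
  using assms by (auto simp: sig_def split: if_splits)

lemma is_trs_trs: "is_trs sig trs"
  by (auto simp: is_trs_def is_rule_def trs_def Let_def sig_simps)

section \<open>The interpretation over the rational numbers\<close>

text \<open>With slope 3/2 for \<open>f\<close>, the choice 5/4 + 1 = (3/2)^2 is the largest slope
  sum allowed for \<open>a\<close>, and (3/2)^4 = 81/16 stays below 4 * 5/4 + 1 = 6. A quadratic
  \<open>g\<close> gives both sides of the first rule the same leading coefficient 9/4. The
  constants 4 and 9 leave a gap of exactly 1 in the second rule.\<close>

definition rat_interp :: "nat \<Rightarrow> rat mpoly" where
  "rat_interp h =
    (if h = 0 then
       Poly_Mapping.single (Poly_Mapping.single 0 1) (3/2) + Poly_Mapping.single 0 4
     else if h = 1 then
       Poly_Mapping.single (Poly_Mapping.single 0 1) (5/4) +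
       Poly_Mapping.single (Poly_Mapping.single 1 1) 1 + Poly_Mapping.single 0 9
     else
       Poly_Mapping.single (Poly_Mapping.single 0 2) 1 +
       Poly_Mapping.single (Poly_Mapping.single 0 1) 1)"

lemma rat_interp_eval:
  "mpoly_eval (rat_interp 0) [x] = 3/2 * x + 4"
  "mpoly_eval (rat_interp (Suc 0)) [x, y] = 5/4 * x + y + 9"
  "mpoly_eval (rat_interp 2) [x] = x * x + x"
  by (simp_all add: rat_interp_def mpoly_eval_add mpoly_eval_single power2_eq_square
      del: single_numeral)

lemma rat_interp_vars:
  "mpoly_vars (rat_interp 0) \<subseteq> {..<1}"
  "mpoly_vars (rat_interp (Suc 0)) \<subseteq> {..<2}"
  "mpoly_vars (rat_interp 2) \<subseteq> {..<1}"
  by (auto simp: rat_interp_def simp del: single_numeral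
      dest!: subsetD[OF mpoly_vars_add] subsetD[OF mpoly_vars_single])

lemma length_1_2_conv:
  "length xs = Suc 0 \<longleftrightarrow> (\<exists>x. xs = [x])"
  "length xs = 2 \<longleftrightarrow> (\<exists>x y. xs = [x, y])"
  by (auto simp: length_Suc_conv numeral_2_eq_2)

lemma well_defined_rat_interp: "well_defined sig rat_interp"
  unfolding well_defined_def
  using rat_interp_vars
  by (auto elim!: sig_cases simp: length_1_2_conv rat_interp_eval carr_def)

text \<open>Linear coefficients of at least 1 preserve the gap 1, and the square in \<open>g\<close>
  is monotone on the carrier.\<close>

lemma monotone_rat_interp: "monotone_wrt (\<lambda>x y. x - y \<ge> 1) sig rat_interp"
proof -
  have "1 \<le> y * y + y - (x * x + x)" if "0 \<le> x" "1 \<le> y - x" for x y :: rat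
    using mult_mono[of x y x y] that by auto
  then show ?thesis
    unfolding monotone_wrt_def
    by (auto elim!: sig_cases simp: length_1_2_conv rat_interp_eval carr_def less_2_cases_iff)
qed

lemma compatible_rat_interp: "compatible_wrt (\<lambda>x y. x - y \<ge> 1) rat_interp trs"
proof -
  have "\<forall>(l, r)\<in>trs. 1 \<le> eval_trm rat_interp \<alpha> l - eval_trm rat_interp \<alpha> r"
    if "range \<alpha> \<subseteq> carr" for \<alpha>
  proof -
    have "0 \<le> \<alpha> 0" using that by (auto simp: carr_def)
    \<comment> \<open>Each difference reduces to an affine function of \<open>\<alpha> 0\<close>
      with nonnegative slope; the constants are 10, 1, 9/4 and 7/2.\<close>
    then show ?thesis by (simp add: trs_def Let_def rat_interp_eval field_simps)
  qed
  then show ?thesis unfolding compatible_wrt_def by fast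
qed

lemma incr_poly_terminating_rat_trs: "incr_poly_terminating_rat sig trs"
proof -
  have "((\<lambda>x y. x - y \<ge> 1), rat_interp) \<in> interps_rat sig"
    unfolding interps_rat_def using well_defined_rat_interp zero_less_one by blast
  then have "poly_terminating (interps_rat sig) sig trs"
    unfolding poly_terminating_def using monotone_rat_interp compatible_rat_interp by blast
  then have "poly_terminating_in (interps_rat sig) sig (Suc 0) trs" by simp
  then show ?thesis
    unfolding incr_poly_terminating_rat_def incr_poly_terminating_def by fastforce
qed

section \<open>No weakly compatible interpretation over the natural numbers\<close>

lemma degree_ge_1_if_mono:
  fixes p :: "int poly"
  assumes "\<And>x y. 0 \<le> x \<Longrightarrow> x < y \<Longrightarrow> poly p x < poly p y"
  shows "1 \<le> degree p"
proof (rule ccontr)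
  assume "\<not> 1 \<le> degree p"
  then obtain c where "p = [:c:]" by (metis degree_eq_zeroE less_one not_le)
  then show False using assms[of 0 1] by simp
qed

lemma not_weakly_compatible_nat:
  assumes wd: "well_defined sig P" and mono: "monotone_wrt (>) sig (P :: nat \<Rightarrow> int mpoly)"
    and compat: "compatible_wrt (\<ge>) P trs"
  shows False
proof -
  define f where "f x = mpoly_eval (P 0) [x]" for x
  define a where "a x y = mpoly_eval (P (Suc 0)) [x, y]" for x y
  define g where "g x = mpoly_eval (P 2) [x]" for x
  have f_nonneg: "0 \<le> f x" if "0 \<le> x" for x
    using wd[unfolded well_defined_def, rule_format, OF sig_simps(1), THEN conjunct2,
        rule_format, of "[x]"] that
    by (simp add: f_def carr_def)
  have g_nonneg: "0 \<le> g x" if "0 \<le> x" for x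
    using wd[unfolded well_defined_def, rule_format, OF sig_simps(3), THEN conjunct2,
        rule_format, of "[x]"] that
    by (simp add: g_def carr_def)
  have a_nonneg: "0 \<le> a x y" if "0 \<le> x" "0 \<le> y" for x y
    using wd[unfolded well_defined_def, rule_format, OF sig_simps(2), THEN conjunct2,
        rule_format, of "[x, y]"] that
    by (simp add: a_def carr_def)
  note mono' = mono[unfolded monotone_wrt_def, rule_format, OF conjI]
  have f_mono: "f x < f y" if "0 \<le> x" "x < y" for x y
    using mono'[OF sig_simps(1), of "[x]" 0 y] that by (simp add: f_def carr_def)
  have g_mono: "g x < g y" if "0 \<le> x" "x < y" for x y
    using mono'[OF sig_simps(3), of "[x]" 0 y] that by (simp add: g_def carr_def)
  have a_mono1: "a x z < a y z" if "0 \<le> x" "x < y" "0 \<le> z" for x y z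
    using mono'[OF sig_simps(2), of "[x, z]" 0 y] that by (simp add: a_def carr_def)
  have a_mono2: "a z x < a z y" if "0 \<le> x" "x < y" "0 \<le> z" for x y z
    using mono'[OF sig_simps(2), of "[z, x]" "Suc 0" y] that by (simp add: a_def carr_def)
  have rules:
    "f (f (g x)) \<le> g (f x) \<and> a x x \<le> f (f x) \<and> a x (a y z) \<le> a (a x y) z \<and>
     f (f (f (f x))) \<le> a x (a x (a x (a x x)))" if "0 \<le> x" "0 \<le> y" "0 \<le> z" for x y z
  proof -
    let ?\<alpha> = "\<lambda>v :: nat. if v = 0 then x else if v = 1 then y else z"
    have "range ?\<alpha> \<subseteq> carr" using that by (auto simp: carr_def)
    then have "\<forall>(l, r)\<in>trs. eval_trm P ?\<alpha> r \<le> eval_trm P ?\<alpha> l"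
      using compat unfolding compatible_wrt_def by fast
    then show ?thesis by (simp add: trs_def Let_def f_def a_def g_def)
  qed
  obtain pf where pf: "\<And>x. f x = poly pf x"
    using mpoly_eval_update_poly[of "P 0" "[0]" 0] unfolding f_def by auto
  obtain pg where pg: "\<And>x. g x = poly pg x"
    using mpoly_eval_update_poly[of "P 2" "[0]" 0] unfolding g_def by auto
  \<comment> \<open>Degrees multiply under composition, so the first rule bounds
    \<open>degree pf\<close> by 1 after cancelling positive degrees.\<close>
  have "degree (pcompose pf (pcompose pf pg)) \<le> degree (pcompose pg pf)"
  proof (rule degree_le_if_poly_le)
    fix n :: int assume "0 \<le> n"
    then show "poly (pcompose pf (pcompose pf pg)) n \<le> poly (pcompose pg pf) n"
      and "0 \<le> poly (pcompose pf (pcompose pf pg)) n"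
      using rules[of n 0 0] f_nonneg g_nonneg by (auto simp: poly_pcompose pf pg)
  qed
  then have "degree pf * (degree pf * degree pg) \<le> 1 * (degree pf * degree pg)"
    by (simp add: degree_pcompose ac_simps)
  moreover have "1 \<le> degree pf" "1 \<le> degree pg"
    using f_mono g_mono unfolding pf pg by (blast intro: degree_ge_1_if_mono)+
  ultimately have "degree pf \<le> 1" by simp
  then obtain s b where f: "\<And>x. f x = s * x + b"
    unfolding pf using poly_degree_le_1 by blast
  \<comment> \<open>The second rule bounds \<open>a\<close> only on the diagonal; monotonicity moves
    both arguments up to \<open>x + y\<close>.\<close>
  have a_le: "a x y \<le> s * s * (x + y) + (s * b + b)" if xy: "0 \<le> x" "0 \<le> y" for x y
  proof -
    have "a x y \<le> a (x + y) y" using a_mono1[of x "x + y" y] xy by (cases "y = 0") auto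
    also have "\<dots> \<le> a (x + y) (x + y)"
      using a_mono2[of y "x + y" "x + y"] xy by (cases "x = 0") auto
    also have "\<dots> \<le> f (f (x + y))" using rules[of "x + y" 0 0] xy by auto
    finally show ?thesis by (simp add: f algebra_simps)
  qed
  obtain p q r where a: "\<And>x y. 0 \<le> y \<Longrightarrow> a x y = p * x + q * y + r"
  proof (rule biaffine_if_bounded[of a])
    show "\<exists>Q. \<forall>x. a x y = poly Q x" for y
      using mpoly_eval_update_poly[of "P (Suc 0)" "[0, y]" 0] unfolding a_def by auto
    show "\<exists>Q. \<forall>y. a x y = poly Q y" for x
      using mpoly_eval_update_poly[of "P (Suc 0)" "[x, 0]" "Suc 0"] unfolding a_def by auto
  qed (use a_nonneg a_le in auto)
  have "1 \<le> p" using a_mono1[of 0 1 0] by (simp add: a)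
  have "1 \<le> q" using a_mono2[of 0 1 0] by (simp add: a)
  have "p + q \<le> s * s"
  proof (rule linear_le_imp_slope_le)
    show "(p + q) * n + r \<le> s * s * n + (s * b + b)" if "0 \<le> n" for n
      using rules[of n 0 0] that by (simp add: a f algebra_simps)
  qed
  \<comment> \<open>Compares the coefficients of \<open>z\<close> in the associativity rule, with
    \<open>x = y = 0\<close>.\<close>
  have "q * q \<le> q"
  proof (rule linear_le_imp_slope_le)
    show "q * q * n + (q * r + r) \<le> q * n + (p * r + r)" if "0 \<le> n" for n
      using rules[of 0 0 n] that a_nonneg[of 0 n] by (simp add: a algebra_simps)
  qed
  then have "q = 1" using \<open>1 \<le> q\<close> by (simp add: mult_le_cancel_left1)
  have "s * s * (s * s) \<le> 4 * p + 1"
  proof (rule linear_le_imp_slope_le)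
    fix n :: int assume n: "0 \<le> n"
    \<comment> \<open>The affine form of \<open>a\<close> requires a nonnegative second argument, so
      the nest is unfolded from the outside in.\<close>
    have nn: "0 \<le> a n n" "0 \<le> a n (a n n)" "0 \<le> a n (a n (a n n))"
      using n by (simp_all add: a_nonneg)
    have "a n (a n (a n (a n n))) = (4 * p + 1) * n + 4 * r"
      unfolding a[OF nn(3)] unfolding a[OF nn(2)] unfolding a[OF nn(1)] unfolding a[OF n]
      by (simp add: \<open>q = 1\<close> algebra_simps)
    then show "s * s * (s * s) * n + (s * s * s * b + s * s * b + s * b + b)
        \<le> (4 * p + 1) * n + 4 * r"
      using rules[of n 0 0] n by (simp add: f algebra_simps)
  qed
  also have "\<dots> \<le> 4 * (s * s) - 3" using \<open>p + q \<le> s * s\<close> \<open>q = 1\<close> by simp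
  finally have "(s * s - 1) * (s * s - 3) \<le> 0" by (simp add: algebra_simps)
  moreover have "2 \<le> s * s" using \<open>p + q \<le> s * s\<close> \<open>q = 1\<close> \<open>1 \<le> p\<close> by linarith
  ultimately have "s * s \<le> 3" by (simp add: mult_le_0_iff)
  \<comment> \<open>No integer square equals 2 or 3.\<close>
  have "\<bar>s\<bar> < 2"
    using \<open>s * s \<le> 3\<close> abs_le_square_iff[of 2 s] by (auto simp: power2_eq_square)
  then have "s = -1 \<or> s = 0 \<or> s = 1" by linarith
  then show False using \<open>2 \<le> s * s\<close> by auto
qed

lemma not_incr_poly_terminating_nat_trs: "\<not> incr_poly_terminating_nat sig trs"
proof
  assume "incr_poly_terminating_nat sig trs"
  then obtain n where n: "n \<ge> 1" "poly_terminating_in (interps_nat sig) sig n trs"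
    by (auto simp: incr_poly_terminating_nat_def incr_poly_terminating_def)
  \<comment> \<open>For \<open>n = 1\<close> strict compatibility implies weak; for larger
    \<open>n\<close> the first step is weakly compatible with the whole system.\<close>
  obtain P where "((>), P) \<in> interps_nat sig" "compatible_wrt (\<ge>) P trs"
  proof (cases "n = 1")
    case True
    with n(2) obtain P where P: "((>), P) \<in> interps_nat sig" "compatible_wrt (>) P trs"
      by (auto simp: poly_terminating_def interps_nat_def)
    then have "compatible_wrt (\<ge>) P trs"
      by (fastforce simp: compatible_wrt_def intro: less_imp_le)
    with P(1) show ?thesis by (rule that)
  next
    case False
    with n(1) obtain m where "n = Suc (Suc m)"
      by (metis One_nat_def not0_implies_Suc not_one_le_zero)
    with n(2) show ?thesis using that by (auto simp: interps_nat_def)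
  qed
  then show False
    using not_weakly_compatible_nat by (auto simp: interps_nat_def)
qed

theorem theorem6p5:
  "\<exists>(F :: nat signature) (R :: (nat, nat) rule set).
     is_trs F R \<and> incr_poly_terminating_rat F R \<and> \<not> incr_poly_terminating_nat F R"
  using is_trs_trs incr_poly_terminating_rat_trs not_incr_poly_terminating_nat_trs by blast

end
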